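(* Let $X$ be a real Hilbert space and let $A$ and $B$ be maximally monotone operators on $X$. Suppose that $Z=(A+B)^{-1}(0)\neq\varnothing$. Then the infimal displacement vector of $(A,B)$ satisfies $v(A,B)=0$; hence the normal problem associated with $(A,B)$ coincides with the original problem of finding a zero of $A+B$, and the set of normal solutions $Z_{v(A,B)}$ equals $Z$.
   Context: Operators on $X$ may be set-valued. The resolvent of a maximally monotone operator $A$ is $J_A=(\operatorname{Id}+A)^{-1}$ (single-valued, defined on all of $X$), and $R_A=2J_A-\operatorname{Id}$. The Douglas–Rachford splitting operator of $(A,B)$ is $T=T_{(A,B)}=J_AR_B+\operatorname{Id}-J_B$; it is firmly nonexpansive, hence $\overline{\operatorname{ran}}(\operatorname{Id}-T)$ (the norm closure of the range) is a nonempty closed convex set. The infimal displacement vector of $(A,B)$ is $v(A,B)=P_{\overline{\operatorname{ran}}(\operatorname{Id}-T)}0$, the element of minimal norm of this set. For $w\in X$, the $w$-perturbed problem of $(A,B)$ is to find the set $Z_w=\{x\in X : 0\in A(x-w)+Bx-w\}$. The normal problem is the $v(A,B)$-perturbed problem, and the set of normal solutions is $Z_{v(A,B)}$. *)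

theory Defs
  imports "HOL-Analysis.Analysis" "HOL-Library.Set_Algebras"
begin

(* A set-valued operator on X is a function 'a => 'a set; its graph is {(x, u). u \<in> A x}.
   Sums of sets below are the Minkowski sums of HOL-Library.Set_Algebras.  The minus sign
   between sets is set difference, so translates are written as images. *)
type_synonym 'a operator = "'a \<Rightarrow> 'a set"

definition monotone_operator :: "'a::real_inner operator \<Rightarrow> bool" where
  "monotone_operator A \<longleftrightarrow>
     (\<forall>x y u v. u \<in> A x \<longrightarrow> v \<in> A y \<longrightarrow> 0 \<le> (x - y) \<bullet> (u - v))"

definition maximally_monotone :: "'a::real_inner operator \<Rightarrow> bool" where
  "maximally_monotone A \<longleftrightarrow>
     monotone_operator A \<and>
     (\<forall>B. monotone_operator B \<longrightarrow> (\<forall>x. A x \<subseteq> B x) \<longrightarrow> B = A)"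

definition op_inverse :: "'a operator \<Rightarrow> 'a operator" where
  "op_inverse A u = {x. u \<in> A x}"

definition op_id :: "'a operator" where
  "op_id x = {x}"

definition op_sum :: "'a::real_inner operator \<Rightarrow> 'a operator \<Rightarrow> 'a operator" where
  "op_sum A B x = A x + B x"

(* The value of the set-valued operator (Id + A)^{-1} at x is a singleton when A is
   maximally monotone on a Hilbert space (Minty); the resolvent selects its element. *)
definition resolvent :: "'a::real_inner operator \<Rightarrow> 'a \<Rightarrow> 'a" where
  "resolvent A x = (THE y. y \<in> op_inverse (op_sum op_id A) x)"

definition reflected_resolvent :: "'a::real_inner operator \<Rightarrow> 'a \<Rightarrow> 'a" where
  "reflected_resolvent A x = 2 *\<^sub>R resolvent A x - x"

definition DR_operator :: "'a::real_inner operator \<Rightarrow> 'a operator \<Rightarrow> 'a \<Rightarrow> 'a" where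
  "DR_operator A B x = resolvent A (reflected_resolvent B x) + x - resolvent B x"

(* The library's closest_point is restricted to heine_borel spaces, which excludes
   infinite-dimensional Hilbert spaces.  For a nonempty closed convex set C in a Hilbert
   space the point described here exists and is unique. *)
definition projection :: "'a::real_inner set \<Rightarrow> 'a \<Rightarrow> 'a" where
  "projection C x = (THE p. p \<in> C \<and> (\<forall>y\<in>C. dist x p \<le> dist x y))"

definition infimal_displacement ::
    "'a::real_inner operator \<Rightarrow> 'a operator \<Rightarrow> 'a" where
  "infimal_displacement A B = projection (closure (range (\<lambda>x. x - DR_operator A B x))) 0"

(* x \<mapsto> A(x - w) + B x - w; the w-perturbed problem is to find a zero of this operator. *)
definition perturbed_sum ::
    "'a::real_inner operator \<Rightarrow> 'a operator \<Rightarrow> 'a \<Rightarrow> 'a operator" where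
  "perturbed_sum A B w x = (\<lambda>u. u - w) ` (A (x - w) + B x)"

definition perturbed_solutions ::
    "'a::real_inner operator \<Rightarrow> 'a operator \<Rightarrow> 'a \<Rightarrow> 'a set" where
  "perturbed_solutions A B w = {x. 0 \<in> perturbed_sum A B w x}"

definition normal_solutions ::
    "'a::real_inner operator \<Rightarrow> 'a operator \<Rightarrow> 'a set" where
  "normal_solutions A B = perturbed_solutions A B (infimal_displacement A B)"

end

theory Submission
  imports Defs
begin

text \<open>
  The infimal displacement vector is the least-norm point of the closure of the range of
  \<open>Id - T\<close>, where \<open>T\<close> is the Douglas--Rachford operator; it is \<open>0\<close> as soon as
  \<open>T\<close> has a fixed point.  A zero \<open>z\<close> of \<open>A + B\<close> supplies one: choose \<open>b \<in> B z\<close> with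
  \<open>- b \<in> A z\<close> and start from \<open>z + b\<close>.  The resolvent of \<open>B\<close> sends \<open>z + b\<close> to \<open>z\<close>, the
  reflection of \<open>z + b\<close> in \<open>z\<close> is \<open>z - b\<close>, and the resolvent of \<open>A\<close> sends \<open>z - b\<close> to \<open>z\<close>
  again, so that \<open>T (z + b) = z + (z + b) - z = z + b\<close>.  At the two points \<open>z + b\<close> and
  \<open>z - b\<close> a value of the set-valued resolvent is thus known explicitly, and monotonicity
  makes it the only one.  The normal problem is then the problem perturbed by \<open>0\<close>, which is
  the original one.
\<close>

text \<open>If also \<open>y + u' = z + u\<close> with \<open>u' \<in> A y\<close>, then \<open>u' - u = - (y - z)\<close>, and
  monotonicity reads \<open>0 \<le> - \<parallel>y - z\<parallel>\<^sup>2\<close>.\<close>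

lemma resolvent_eqI:
  assumes mono: "monotone_operator A" and u: "u \<in> A z"
  shows "resolvent A (z + u) = z"
  unfolding resolvent_def
proof (rule the_equality)
  show "z \<in> op_inverse (op_sum op_id A) (z + u)"
    using u by (auto simp: op_inverse_def op_sum_def op_id_def set_plus_def)
next
  fix y
  assume "y \<in> op_inverse (op_sum op_id A) (z + u)"
  then obtain u' where u': "u' \<in> A y" "z + u = y + u'"
    by (auto simp: op_inverse_def op_sum_def op_id_def set_plus_def)
  have "0 \<le> (y - z) \<bullet> (u' - u)"
    using mono u u'(1) by (simp add: monotone_operator_def)
  also have "u' - u = - (y - z)"
    using u'(2) by (simp add: algebra_simps)
  finally have "(y - z) \<bullet> (y - z) \<le> 0"
    by (simp only: inner_minus_right neg_0_le_iff_le)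
  then show "y = z"
    by (metis inner_gt_zero_iff not_less right_minus_eq)
qed

lemma DR_operator_fixed_point:
  assumes "monotone_operator A" and "monotone_operator B"
    and a: "- b \<in> A z" and b: "b \<in> B z"
  shows "DR_operator A B (z + b) = z + b"
proof -
  have JB: "resolvent B (z + b) = z"
    using assms by (intro resolvent_eqI)
  have "reflected_resolvent B (z + b) = z + - b"
    by (simp add: reflected_resolvent_def JB scaleR_2)
  moreover have "resolvent A (z + - b) = z"
    using assms by (intro resolvent_eqI)
  ultimately show ?thesis
    by (simp add: DR_operator_def JB)
qed

lemma projection_self:
  assumes "p \<in> C"
  shows "projection C p = p"
  unfolding projection_def
proof (rule the_equality)
  show "p \<in> C \<and> (\<forall>y\<in>C. dist p p \<le> dist p y)"
    using assms by simp
next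
  fix q
  assume "q \<in> C \<and> (\<forall>y\<in>C. dist p q \<le> dist p y)"
  then have "dist p q \<le> dist p p"
    using assms by blast
  then show "q = p"
    by simp
qed

lemma infimal_displacement_eq_0:
  assumes "DR_operator A B x = x"
  shows "infimal_displacement A B = 0"
proof -
  have "0 \<in> range (\<lambda>x. x - DR_operator A B x)"
    using assms by (intro range_eqI[of _ _ x]) simp
  then show ?thesis
    unfolding infimal_displacement_def by (intro projection_self closure_subset[THEN subsetD])
qed

lemma perturbed_sum_0: "perturbed_sum A B 0 = op_sum A B"
  by (rule ext) (simp add: perturbed_sum_def op_sum_def)

theorem mainTheorem3:
  fixes A B :: "'a::{real_inner, complete_space} operator"
  assumes "maximally_monotone A" and "maximally_monotone B"
    and "op_inverse (op_sum A B) 0 \<noteq> {}"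
  shows "infimal_displacement A B = 0
    \<and> perturbed_sum A B (infimal_displacement A B) = op_sum A B
    \<and> normal_solutions A B = op_inverse (op_sum A B) 0"
proof -
  obtain z where "0 \<in> A z + B z"
    using assms(3) by (auto simp: op_inverse_def op_sum_def)
  then obtain a b where "0 = a + b" "a \<in> A z" and b: "b \<in> B z"
    by (rule set_plus_elim)
  then have "a = - b" and "a \<in> A z"
    by (simp_all add: eq_neg_iff_add_eq_0)
  then have a: "- b \<in> A z"
    by simp
  have "DR_operator A B (z + b) = z + b"
    using assms(1,2) a b by (intro DR_operator_fixed_point) (auto simp: maximally_monotone_def)
  then have v: "infimal_displacement A B = 0"
    by (rule infimal_displacement_eq_0)
  then show ?thesis
    by (simp add: perturbed_sum_0 normal_solutions_def perturbed_solutions_def op_inverse_def)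
qed

end
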